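(* Let $\mathcal{X}$ be the class of (nonempty) permutations avoiding all of $2143$, $2413$, $3142$, $3412$. For $n \geq 1$ let $\mathcal{X}_n$ be the set of permutations of size $n$ in $\mathcal{X}$, let $x_n = |\mathcal{X}_n|$, and let $w_n$ be the number of equivalence classes of the relation of Wilf-equivalence in $\mathcal{X}$ restricted to $\mathcal{X}_n$. Then \[ x_n^{1/n} \to 2+\sqrt{2} \quad\text{and}\quad w_n^{1/n} \to 1 \quad \text{as } n \to \infty . \]
   Context: A permutation of size $n$ is a bijection of $\{1,\dots,n\}$, written in one-line notation. A permutation $\pi$ of size $k$ is contained in a permutation $\tau$, written $\pi \leq \tau$, if $\tau$ has a subsequence of $k$ entries in the same relative order as $\pi$; otherwise $\tau$ avoids $\pi$. Wilf-equivalence in $\mathcal{X}$: for $\alpha,\beta\in\mathcal{X}$, $\alpha$ and $\beta$ are Wilf-equivalent in $\mathcal{X}$ if for every $m$ the number of permutations of size $m$ in $\mathcal{X}$ avoiding $\alpha$ equals the number of permutations of size $m$ in $\mathcal{X}$ avoiding $\beta$. *)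

theory Defs
  imports Complex_Main "HOL-Library.Sublist" "HOL-Combinatorics.Multiset_Permutations"
begin

text \<open>
  Permutations are represented by their one-line notation: the permutations of size \<open>n\<close> are the
  lists in \<open>permutations_of_set {1..n}\<close>, i.e. the distinct lists with set of entries \<open>{1..n}\<close>.
\<close>

definition perms :: "nat \<Rightarrow> nat list set" where
  "perms n = permutations_of_set {1..n}"

lemma length_perms: "\<tau> \<in> perms n \<Longrightarrow> length \<tau> = n"
  using length_finite_permutations_of_set[of \<tau> "{1..n}"] by (simp add: perms_def)

definition same_relative_order :: "nat list \<Rightarrow> nat list \<Rightarrow> bool" where
  "same_relative_order xs ys \<longleftrightarrow>
     length xs = length ys \<and>
     (\<forall>i < length xs. \<forall>j < length xs. xs ! i < xs ! j \<longleftrightarrow> ys ! i < ys ! j)"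

definition contained_in :: "nat list \<Rightarrow> nat list \<Rightarrow> bool" where
  "contained_in \<pi> \<tau> \<longleftrightarrow> (\<exists>\<sigma>. subseq \<sigma> \<tau> \<and> same_relative_order \<pi> \<sigma>)"

abbreviation avoids :: "nat list \<Rightarrow> nat list \<Rightarrow> bool" where
  "avoids \<tau> \<pi> \<equiv> \<not> contained_in \<pi> \<tau>"

definition of_size :: "nat list set \<Rightarrow> nat \<Rightarrow> nat list set" where
  "of_size C n = {\<tau> \<in> C. length \<tau> = n}"

definition wilf_equivalence :: "nat list set \<Rightarrow> (nat list \<times> nat list) set" where
  "wilf_equivalence C =
     {(\<alpha>, \<beta>). \<alpha> \<in> C \<and> \<beta> \<in> C \<and>
        (\<forall>m. card {\<tau> \<in> of_size C m. avoids \<tau> \<alpha>} = card {\<tau> \<in> of_size C m. avoids \<tau> \<beta>})}"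

definition num_wilf_classes :: "nat list set \<Rightarrow> nat \<Rightarrow> nat" where
  "num_wilf_classes C n = card (of_size C n // Restr (wilf_equivalence C) (of_size C n))"

definition X_class :: "nat list set" where
  "X_class = {\<tau> \<in> (\<Union>n\<in>{1..}. perms n).
     avoids \<tau> [2,1,4,3] \<and> avoids \<tau> [2,4,1,3] \<and> avoids \<tau> [3,1,4,2] \<and> avoids \<tau> [3,4,1,2]}"

lemma equiv_wilf_equivalence:
  "equiv (of_size C n) (Restr (wilf_equivalence C) (of_size C n))"
  by (rule equivI) (auto simp: refl_on_def sym_def trans_def wilf_equivalence_def of_size_def)

lemma of_size_X_class:
  assumes "n \<ge> 1"
  shows "of_size X_class n = {\<tau> \<in> perms n.
     avoids \<tau> [2,1,4,3] \<and> avoids \<tau> [2,4,1,3] \<and> avoids \<tau> [3,1,4,2] \<and> avoids \<tau> [3,4,1,2]}"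
  using assms
  by (auto simp: of_size_def X_class_def dest: length_perms)

lemma finite_of_size_X_class: "finite (of_size X_class n)"
proof (rule finite_subset)
  show "of_size X_class n \<subseteq> perms n"
    by (auto simp: of_size_def X_class_def dest: length_perms)
qed (simp add: perms_def)

end

theory Submission
  imports Defs "HOL-Library.FuncSet" "HOL-Computational_Algebra.Formal_Power_Series"
begin

text \<open>
  A member of the class of size at least 2 has an entry in one of the four corners of its diagram,
  and removing that entry stays in the class. Peeling off corners shows that \<open>x\<^sub>n\<close> satisfies
  \<open>x\<^sub>n = 4 x\<^sub>n\<^sub>-\<^sub>1 - 2 x\<^sub>n\<^sub>-\<^sub>2\<close>. The same inclusion-exclusion applied to
  the number of members containing a fixed \<open>\<alpha>\<close> gives a linear recurrence: if
  \<open>\<alpha>\<close> consists of \<open>\<beta>\<close> with \<open>a\<close> points added below left and \<open>b\<close> points above right, and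
  \<open>\<beta>\<close> has no such corner, then the generating function of \<open>\<alpha>\<close> is that of \<open>\<beta>\<close>
  times a power series depending only on \<open>a\<close> and \<open>b\<close>. Hence the Wilf class of \<open>\<alpha>\<close> is determined by
  the multiset of the pairs \<open>(a, b)\<close> met while peeling. The weight generating function
  \<open>\<Prod>1 / (1 - x\<^bsup>a+b\<^esup>)\<close> of these multisets converges for \<open>\<bar>x\<bar> < 1\<close>, so their number
  grows subexponentially.
\<close>

section \<open>Relative order, containment and reversal\<close>

lemma perms_iff: "\<tau> \<in> perms n \<longleftrightarrow> set \<tau> = {1..n} \<and> distinct \<tau>"
  by (auto simp: perms_def permutations_of_set_def)

lemma finite_perms [simp]: "finite (perms n)"
  by (simp add: perms_def)

lemma rev_in_perms_iff [simp]: "rev \<tau> \<in> perms n \<longleftrightarrow> \<tau> \<in> perms n"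
  by (simp add: perms_iff)

lemma same_relative_order_Nil [simp]: "same_relative_order [] ys \<longleftrightarrow> ys = []"
  by (auto simp: same_relative_order_def)

lemma same_relative_order_Nil2 [simp]: "same_relative_order xs [] \<longleftrightarrow> xs = []"
  by (auto simp: same_relative_order_def)

text \<open>Makes the relation computable entry by entry, so that the simplifier can decide it for
  the explicit patterns of length four.\<close>

lemma same_relative_order_Cons [simp]:
  "same_relative_order (x # xs) (y # ys) \<longleftrightarrow>
     same_relative_order xs ys \<and> list_all2 (\<lambda>a b. (x < a \<longleftrightarrow> y < b) \<and> (a < x \<longleftrightarrow> b < y)) xs ys"
  unfolding same_relative_order_def list_all2_conv_all_nth
  by (simp add: All_less_Suc2 conj_ac) blast

lemma same_relative_order_rev [simp]:
  "same_relative_order (rev xs) (rev ys) \<longleftrightarrow> same_relative_order xs ys"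
proof -
  have *: "same_relative_order (rev xs) (rev ys)" if "same_relative_order xs ys" for xs ys
    unfolding same_relative_order_def
  proof (intro conjI allI impI)
    show "length (rev xs) = length (rev ys)"
      using that by (simp add: same_relative_order_def)
  next
    fix i j assume "i < length (rev xs)" "j < length (rev xs)"
    then show "rev xs ! i < rev xs ! j \<longleftrightarrow> rev ys ! i < rev ys ! j"
      using that by (simp add: same_relative_order_def rev_nth)
  qed
  show ?thesis
    using *[of xs ys] *[of "rev xs" "rev ys"] by auto
qed

lemma same_relative_order_map_Suc [simp]:
  "same_relative_order (map Suc xs) ys \<longleftrightarrow> same_relative_order xs ys"
  "same_relative_order xs (map Suc ys) \<longleftrightarrow> same_relative_order xs ys"
  by (auto simp: same_relative_order_def)

lemma subseq_rev: "subseq xs ys \<Longrightarrow> subseq (rev xs) (rev ys)"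
  by (induction rule: list_emb.induct) (auto intro: subseq_rev_drop_many list_emb_append_mono)

lemma contained_in_rev [simp]: "contained_in (rev \<pi>) (rev \<tau>) \<longleftrightarrow> contained_in \<pi> \<tau>"
proof -
  have *: "contained_in (rev \<pi>) (rev \<tau>)" if "contained_in \<pi> \<tau>" for \<pi> \<tau>
    using that unfolding contained_in_def
    by (metis same_relative_order_rev subseq_rev)
  show ?thesis
    using *[of \<pi> \<tau>] *[of "rev \<pi>" "rev \<tau>"] by auto
qed

lemma contained_in_rev_left: "contained_in (rev \<pi>) \<tau> \<longleftrightarrow> contained_in \<pi> (rev \<tau>)"
  by (metis contained_in_rev rev_rev_ident)

lemma contained_in_length: "contained_in \<pi> \<tau> \<Longrightarrow> length \<pi> \<le> length \<tau>"
  by (auto simp: contained_in_def same_relative_order_def dest: list_emb_length)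

lemma contained_in_Nil [simp]: "contained_in [] \<tau>"
  by (auto simp: contained_in_def)

text \<open>Adding and deleting a point in the south-west and north-east corner; the other two corners
  are reached by conjugating with \<open>rev\<close>.\<close>

definition sw :: "nat list \<Rightarrow> nat list" where
  "sw \<pi> = 1 # map Suc \<pi>"

definition ne :: "nat list \<Rightarrow> nat list" where
  "ne \<pi> = \<pi> @ [Suc (length \<pi>)]"

text \<open>Deletion is the identity when the corner is empty. With this convention the containment
  criteria for \<open>sw\<close> and \<open>ne\<close> need no case distinction in their
  statements.\<close>

definition del_sw :: "nat list \<Rightarrow> nat list" where
  "del_sw \<pi> = (if \<pi> \<noteq> [] \<and> hd \<pi> = 1 then map (\<lambda>x. x - 1) (tl \<pi>) else \<pi>)"

definition del_ne :: "nat list \<Rightarrow> nat list" where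
  "del_ne \<pi> = (if \<pi> \<noteq> [] \<and> last \<pi> = length \<pi> then butlast \<pi> else \<pi>)"

lemma length_sw [simp]: "length (sw \<pi>) = Suc (length \<pi>)"
  and length_ne [simp]: "length (ne \<pi>) = Suc (length \<pi>)"
  by (simp_all add: sw_def ne_def)

lemma sw_ne_neq_Nil [simp]: "sw \<pi> \<noteq> []" "ne \<pi> \<noteq> []"
  by (simp_all add: sw_def ne_def)

lemma hd_sw [simp]: "hd (sw \<pi>) = 1"
  and last_ne [simp]: "last (ne \<pi>) = Suc (length \<pi>)"
  and last_sw: "\<pi> \<noteq> [] \<Longrightarrow> last (sw \<pi>) = Suc (last \<pi>)"
  and hd_ne: "\<pi> \<noteq> [] \<Longrightarrow> hd (ne \<pi>) = hd \<pi>"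
  by (simp_all add: sw_def ne_def last_map)

lemma del_sw_sw [simp]: "del_sw (sw \<pi>) = \<pi>"
  and del_ne_ne [simp]: "del_ne (ne \<pi>) = \<pi>"
  by (simp_all add: del_sw_def sw_def comp_def del_ne_def ne_def)

lemma inj_sw: "inj sw" and inj_ne: "inj ne"
  by (metis injI del_sw_sw, metis injI del_ne_ne)

lemma ne_sw: "ne (sw \<pi>) = sw (ne \<pi>)"
  by (simp add: ne_def sw_def)

lemma sw_in_perms [simp]: "sw \<pi> \<in> perms (Suc n) \<longleftrightarrow> \<pi> \<in> perms n"
proof -
  \<comment> \<open>If 0 occurs in \<pi>, both sides of the lemma fail: \<open>sw \<pi>\<close>
    repeats 1, and 0 is not an entry allowed in \<open>perms n\<close>. Otherwise only this identity
    of sets remains.\<close>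
  have "insert 1 (Suc ` set \<pi>) = {1..Suc n} \<longleftrightarrow> set \<pi> = {1..n}" (is "?L \<longleftrightarrow> ?R")
    if "0 \<notin> set \<pi>"
  proof
    assume ?L
    have "Suc ` set \<pi> = insert 1 (Suc ` set \<pi>) - {1}"
      using that by auto
    also have "\<dots> = Suc ` {1..n}"
      using \<open>?L\<close> by (auto simp: image_Suc_atLeastAtMost)
    finally show ?R
      by (metis inj_Suc inj_image_eq_iff)
  next
    assume ?R
    then show ?L
      by (auto simp: image_Suc_atLeastAtMost)
  qed
  then show ?thesis
    by (auto simp: perms_iff sw_def distinct_map)
qed

lemma ne_in_perms [simp]:
  assumes "\<pi> \<in> perms n"
  shows "ne \<pi> \<in> perms (Suc n)"
  using assms length_perms[OF assms] by (auto simp: perms_iff ne_def)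

lemma perms_hd_eq_1:
  assumes "\<tau> \<in> perms (Suc n)" "hd \<tau> = 1"
  obtains \<pi> where "\<tau> = sw \<pi>" "\<pi> \<in> perms n"
proof -
  obtain xs where xs: "\<tau> = 1 # xs"
    using assms length_perms[OF assms(1)] by (cases \<tau>) auto
  have "\<forall>x\<in>set xs. x \<noteq> 0"
    using assms xs by (metis One_nat_def atLeastAtMost_iff list.set_intros(2) not_one_le_zero perms_iff)
  then have "\<tau> = sw (map (\<lambda>x. x - 1) xs)"
    by (auto simp: xs sw_def comp_def map_idI)
  then show ?thesis
    using that assms(1) by (metis sw_in_perms)
qed

lemma perms_last_eq:
  assumes "\<tau> \<in> perms (Suc n)" "last \<tau> = Suc n"
  obtains \<pi> where "\<tau> = ne \<pi>" "\<pi> \<in> perms n"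
proof -
  obtain xs where xs: "\<tau> = xs @ [Suc n]"
    using assms length_perms[OF assms(1)] by (cases \<tau> rule: rev_cases) auto
  moreover have "length xs = n"
    using xs length_perms[OF assms(1)] by simp
  moreover have "xs \<in> perms n"
  proof -
    have eq: "insert (Suc n) (set xs) = {1..Suc n}" and "Suc n \<notin> set xs" "distinct xs"
      using assms(1) xs by (simp_all add: perms_iff)
    then have "set xs = {1..Suc n} - {Suc n}"
      by blast
    also have "\<dots> = {1..n}"
      by auto
    finally show ?thesis
      using \<open>distinct xs\<close> by (simp add: perms_iff)
  qed
  ultimately show ?thesis
    using that by (auto simp: ne_def)
qed

lemma del_sw_in_perms:
  assumes "\<alpha> \<in> perms n"
  shows "\<exists>k. del_sw \<alpha> \<in> perms k"
proof (cases "\<alpha> \<noteq> [] \<and> hd \<alpha> = 1")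
  case True
  then obtain m where "n = Suc m"
    using length_perms[OF assms] by (cases n) auto
  then show ?thesis
    using True assms by (metis perms_hd_eq_1 del_sw_sw)
qed (use assms in \<open>auto simp: del_sw_def\<close>)

section \<open>Containment in a permutation with an added corner point\<close>

lemma subseq_Cons_right_iff:
  "subseq xs (y # ys) \<longleftrightarrow> subseq xs ys \<or> (\<exists>zs. xs = y # zs \<and> subseq zs ys)"
  by (cases xs) (auto dest: subseq_Cons')

lemma subseq_map_Suc_iff: "subseq xs (map Suc ys) \<longleftrightarrow> (\<exists>zs. xs = map Suc zs \<and> subseq zs ys)"
proof
  show "subseq xs (map Suc ys) \<Longrightarrow> \<exists>zs. xs = map Suc zs \<and> subseq zs ys"
  proof (induction ys arbitrary: xs)
    case Nil
    then show ?case
      by (intro exI[of _ "[]"]) simp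
  next
    case (Cons y ys)
    show ?case
      using Cons.prems Cons.IH by (simp add: subseq_Cons_right_iff) (metis list.map(2))
  qed
qed (auto simp: subseq_map)

lemma subseq_snoc_right_iff:
  "subseq xs (ys @ [y]) \<longleftrightarrow> subseq xs ys \<or> (\<exists>zs. xs = zs @ [y] \<and> subseq zs ys)"
  using subseq_Cons_right_iff[of "rev xs" y "rev ys"]
  by (metis rev.simps(2) rev_rev_ident subseq_rev)

lemma same_relative_order_snoc [simp]:
  "same_relative_order (xs @ [x]) (ys @ [y]) \<longleftrightarrow>
     same_relative_order xs ys \<and> list_all2 (\<lambda>a b. (x < a \<longleftrightarrow> y < b) \<and> (a < x \<longleftrightarrow> b < y)) xs ys"
  using same_relative_order_rev[of "xs @ [x]" "ys @ [y]"] by simp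

lemma subseq_set_subset: "subseq xs ys \<Longrightarrow> set xs \<subseteq> set ys"
  by (auto elim: list_emb_set)

lemma ne_in_perms_iff [simp]: "ne \<pi> \<in> perms (Suc n) \<longleftrightarrow> \<pi> \<in> perms n"
proof
  assume *: "ne \<pi> \<in> perms (Suc n)"
  then have "last (ne \<pi>) = Suc n"
    using length_perms[OF *] by simp
  with * obtain \<pi>' where "ne \<pi> = ne \<pi>'" "\<pi>' \<in> perms n"
    by (rule perms_last_eq)
  then show "\<pi> \<in> perms n"
    by (metis del_ne_ne)
qed simp

text \<open>The new point lies below and to the left of everything else, so in a copy of \<alpha> it
  can only represent a south-west corner of \<alpha>. If \<alpha> has such a corner, using the new
  point for it costs nothing.\<close>

lemma contained_in_sw_iff:
  assumes \<alpha>: "\<alpha> \<in> perms n" and \<tau>: "\<tau> \<in> perms m"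
  shows "contained_in \<alpha> (sw \<tau>) \<longleftrightarrow> contained_in (del_sw \<alpha>) \<tau>"
proof (cases "\<exists>\<alpha>'. \<alpha> = sw \<alpha>'")
  case True
  then obtain \<alpha>' where [simp]: "\<alpha> = sw \<alpha>'"
    by auto
  show ?thesis
  proof
    assume "contained_in \<alpha> (sw \<tau>)"
    then obtain \<sigma> where \<sigma>: "subseq \<sigma> (1 # map Suc \<tau>)" "same_relative_order (1 # map Suc \<alpha>') \<sigma>"
      by (auto simp: contained_in_def sw_def)
    then obtain s \<rho> where [simp]: "\<sigma> = s # \<rho>"
      by (cases \<sigma>) auto
    \<comment> \<open>Whether or not \<open>s\<close> is the new point, everything after the first
      entry of the copy comes from \<tau>.\<close>
    have "subseq \<rho> (map Suc \<tau>)"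
      using \<sigma>(1) by (auto simp: subseq_Cons_right_iff dest: subseq_Cons')
    then show "contained_in (del_sw \<alpha>) \<tau>"
      using \<sigma>(2) by (auto simp: contained_in_def subseq_map_Suc_iff)
  next
    assume "contained_in (del_sw \<alpha>) \<tau>"
    then obtain \<sigma> where \<sigma>: "subseq \<sigma> \<tau>" "same_relative_order \<alpha>' \<sigma>"
      by (auto simp: contained_in_def)
    have sub: "subseq (1 # map Suc \<sigma>) (sw \<tau>)"
      using \<sigma>(1) by (simp add: sw_def subseq_map)
    have "0 \<notin> set \<alpha>'" "0 \<notin> set \<sigma>"
      using \<alpha> \<tau> subseq_set_subset[OF \<sigma>(1)] by (auto simp: perms_iff sw_def)
    moreover have "length \<alpha>' = length \<sigma>"
      using \<sigma>(2) by (simp add: same_relative_order_def)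
    ultimately have "same_relative_order \<alpha> (1 # map Suc \<sigma>)"
      using \<sigma>(2) by (auto simp: sw_def list_all2_conv_all_nth in_set_conv_nth)
    then show "contained_in \<alpha> (sw \<tau>)"
      using sub by (auto simp: contained_in_def)
  qed
next
  case False
  then have hd: "hd \<alpha> \<noteq> 1" if "\<alpha> \<noteq> []"
    using that \<alpha> length_perms[OF \<alpha>] perms_hd_eq_1[of \<alpha> "n - 1"] by (cases n) auto
  then have [simp]: "del_sw \<alpha> = \<alpha>"
    by (auto simp: del_sw_def)
  have "contained_in \<alpha> (sw \<tau>) \<longleftrightarrow> contained_in \<alpha> (map Suc \<tau>)"
  proof
    assume "contained_in \<alpha> (sw \<tau>)"
    then obtain \<sigma> where \<sigma>: "subseq \<sigma> (1 # map Suc \<tau>)" "same_relative_order \<alpha> \<sigma>"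
      by (auto simp: contained_in_def sw_def)
    have "subseq \<sigma> (map Suc \<tau>)"
    proof (rule ccontr)
      assume "\<not> subseq \<sigma> (map Suc \<tau>)"
      then obtain \<rho> where [simp]: "\<sigma> = 1 # map Suc \<rho>" and \<rho>: "subseq \<rho> \<tau>"
        using \<sigma>(1) by (auto simp: subseq_Cons_right_iff subseq_map_Suc_iff)
      obtain a as where [simp]: "\<alpha> = a # as"
        using \<sigma>(2) by (cases \<alpha>) auto
      have "0 \<notin> set \<rho>"
        using \<tau> subseq_set_subset[OF \<rho>] by (auto simp: perms_iff)
      \<comment> \<open>A copy that uses the new point starts with its minimum, hence so does
        \<alpha>, which forces \<open>a = 1\<close>.\<close>
      then have "\<forall>x\<in>set as. a < x"
        using \<sigma>(2) by (auto simp: list_all2_conv_all_nth in_set_conv_nth)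
      moreover have "a \<in> {1..n}" "{1..n} = insert a (set as)"
        using \<alpha> by (auto simp: perms_iff)
      ultimately have "a = 1"
        by (metis One_nat_def atLeastAtMost_iff insert_iff le_trans linorder_not_less order_refl)
      then show False
        using hd by simp
    qed
    then show "contained_in \<alpha> (map Suc \<tau>)"
      using \<sigma>(2) by (auto simp: contained_in_def)
  qed (auto simp: contained_in_def sw_def subseq_Cons_right_iff)
  also have "\<dots> \<longleftrightarrow> contained_in \<alpha> \<tau>"
    by (auto simp: contained_in_def subseq_map_Suc_iff intro: subseq_map)
  finally show ?thesis
    by simp
qed

text \<open>Reversal alone does not carry the south-west corner to the north-east one, so the
  argument for \<open>sw\<close> is repeated with last entries and maxima.\<close>

lemma contained_in_ne_iff:
  assumes \<alpha>: "\<alpha> \<in> perms n" and \<tau>: "\<tau> \<in> perms m"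
  shows "contained_in \<alpha> (ne \<tau>) \<longleftrightarrow> contained_in (del_ne \<alpha>) \<tau>"
proof (cases "\<exists>\<alpha>'. \<alpha> = ne \<alpha>'")
  case True
  then obtain \<alpha>' where [simp]: "\<alpha> = ne \<alpha>'"
    by auto
  show ?thesis
  proof
    assume "contained_in \<alpha> (ne \<tau>)"
    then obtain \<sigma> where \<sigma>: "subseq \<sigma> (\<tau> @ [Suc (length \<tau>)])" "same_relative_order \<alpha> \<sigma>"
      by (auto simp: contained_in_def ne_def)
    then obtain s \<rho> where [simp]: "\<sigma> = \<rho> @ [s]"
      by (cases \<sigma> rule: rev_cases) auto
    have "subseq \<rho> (\<rho> @ [s])"
      by (simp add: subseq_rev_drop_many)
    then have "subseq \<rho> \<tau>"
      using \<sigma>(1) by (auto simp: subseq_snoc_right_iff intro: subseq_order.trans)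
    moreover have "same_relative_order \<alpha>' \<rho>"
      using \<sigma>(2) by (simp add: ne_def)
    ultimately show "contained_in (del_ne \<alpha>) \<tau>"
      by (auto simp: contained_in_def)
  next
    assume "contained_in (del_ne \<alpha>) \<tau>"
    then obtain \<sigma> where \<sigma>: "subseq \<sigma> \<tau>" "same_relative_order \<alpha>' \<sigma>"
      by (auto simp: contained_in_def)
    have sub: "subseq (\<sigma> @ [Suc (length \<tau>)]) (ne \<tau>)"
      using \<sigma>(1) by (simp add: ne_def)
    have "n = Suc (length \<alpha>')" "m = length \<tau>"
      using length_perms[OF \<alpha>] length_perms[OF \<tau>] by simp_all
    then have "\<alpha>' \<in> perms (length \<alpha>')" "\<tau> \<in> perms (length \<tau>)"
      using \<alpha> \<tau> by simp_all
    then have "\<forall>x\<in>set \<alpha>'. x < Suc (length \<alpha>')" "\<forall>x\<in>set \<sigma>. x < Suc (length \<tau>)"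
      using subseq_set_subset[OF \<sigma>(1)] by (auto simp: perms_iff)
    moreover have "length \<alpha>' = length \<sigma>"
      using \<sigma>(2) by (simp add: same_relative_order_def)
    ultimately have "same_relative_order \<alpha> (\<sigma> @ [Suc (length \<tau>)])"
      using \<sigma>(2) by (auto simp: ne_def list_all2_conv_all_nth dest: nth_mem order.asym)
    then show "contained_in \<alpha> (ne \<tau>)"
      using sub by (auto simp: contained_in_def)
  qed
next
  case False
  then have last: "last \<alpha> \<noteq> n" if "\<alpha> \<noteq> []"
    using that \<alpha> length_perms[OF \<alpha>] perms_last_eq[of \<alpha> "n - 1"] by (cases n) auto
  then have [simp]: "del_ne \<alpha> = \<alpha>"
    using length_perms[OF \<alpha>] by (auto simp: del_ne_def)
  have "contained_in \<alpha> (ne \<tau>) \<longleftrightarrow> contained_in \<alpha> \<tau>"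
  proof
    assume "contained_in \<alpha> (ne \<tau>)"
    then obtain \<sigma> where \<sigma>: "subseq \<sigma> (\<tau> @ [Suc (length \<tau>)])" "same_relative_order \<alpha> \<sigma>"
      by (auto simp: contained_in_def ne_def)
    have "subseq \<sigma> \<tau>"
    proof (rule ccontr)
      assume "\<not> subseq \<sigma> \<tau>"
      then obtain \<rho> where [simp]: "\<sigma> = \<rho> @ [Suc (length \<tau>)]" and \<rho>: "subseq \<rho> \<tau>"
        using \<sigma>(1) by (auto simp: subseq_snoc_right_iff)
      obtain a as where [simp]: "\<alpha> = as @ [a]"
        using \<sigma>(2) by (cases \<alpha> rule: rev_cases) auto
      have "\<forall>x\<in>set \<rho>. x < Suc (length \<tau>)"
        using \<tau> length_perms[OF \<tau>] subseq_set_subset[OF \<rho>] by (auto simp: perms_iff)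
      then have "\<forall>x\<in>set as. x < a"
        using \<sigma>(2) by (auto simp: list_all2_conv_all_nth all_set_conv_all_nth)
      moreover have "a \<in> {1..n}" "{1..n} = insert a (set as)"
        using \<alpha> by (auto simp: perms_iff)
      ultimately have "a = n"
        by (metis atLeastAtMost_iff insert_iff le_antisym le_trans less_imp_le order_refl)
      then show False
        using last by simp
    qed
    then show "contained_in \<alpha> \<tau>"
      using \<sigma>(2) by (auto simp: contained_in_def)
  qed (auto simp: contained_in_def ne_def subseq_snoc_right_iff)
  then show ?thesis
    by simp
qed

section \<open>The class and its corners\<close>

text \<open>Unlike the class itself, \<open>Xs 0\<close> contains the empty permutation, so that the recurrences
  below already hold for sizes 0, 1, 2.\<close>

definition Xs :: "nat \<Rightarrow> nat list set" where
  "Xs m = {\<tau> \<in> perms m.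
     avoids \<tau> [2,1,4,3] \<and> avoids \<tau> [2,4,1,3] \<and> avoids \<tau> [3,1,4,2] \<and> avoids \<tau> [3,4,1,2]}"

lemma of_size_X_class_eq_Xs: "n \<ge> 1 \<Longrightarrow> of_size X_class n = Xs n"
  by (simp add: of_size_X_class Xs_def)

lemma Xs_subset_perms: "\<tau> \<in> Xs m \<Longrightarrow> \<tau> \<in> perms m"
  by (simp add: Xs_def)

lemma length_Xs: "\<tau> \<in> Xs m \<Longrightarrow> length \<tau> = m"
  by (auto simp: Xs_def dest: length_perms)

lemma finite_Xs [simp]: "finite (Xs m)"
  by (rule finite_subset[of _ "perms m"]) (auto simp: Xs_def)

lemma basis_in_perms:
  "[2,1,4,3] \<in> perms 4" "[2,4,1,3] \<in> perms 4" "[3,1,4,2] \<in> perms 4" "[3,4,1,2] \<in> perms 4"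
  by (auto simp: perms_iff)

text \<open>Reversal permutes the basis: it exchanges 2143 with 3412 and 2413 with 3142.\<close>

lemma rev_in_Xs_iff [simp]: "rev \<tau> \<in> Xs m \<longleftrightarrow> \<tau> \<in> Xs m"
  by (auto simp: Xs_def contained_in_rev_left[symmetric])

text \<open>No basis pattern starts with 1, so \<open>del_sw\<close> fixes all four and a new
  south-west point cannot take part in a forbidden pattern.\<close>

lemma sw_in_Xs_iff [simp]: "sw \<tau> \<in> Xs (Suc m) \<longleftrightarrow> \<tau> \<in> Xs m"
  using basis_in_perms by (auto simp: Xs_def contained_in_sw_iff del_sw_def)

text \<open>Likewise, no basis pattern ends with 4.\<close>

lemma ne_in_Xs_iff [simp]: "ne \<tau> \<in> Xs (Suc m) \<longleftrightarrow> \<tau> \<in> Xs m"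
  using basis_in_perms by (auto simp: Xs_def contained_in_ne_iff del_ne_def)

lemma subseq_four: "subseq [f, a, b, l] (f # us @ a # vs @ b # ws @ [l])"
  by (simp add: subseq_drop_many)

text \<open>If all corners are empty, the values 1 and \<open>m\<close> lie strictly between the
  first and the last position. Together with the first and last entries they form one of the four
  basis patterns; which one depends on the order of 1 and \<open>m\<close> and on the order of the
  two end entries.\<close>

lemma Xs_corner:
  assumes \<tau>: "\<tau> \<in> Xs m" and m: "m \<ge> 2"
  shows "hd \<tau> = 1 \<or> last \<tau> = m \<or> hd \<tau> = m \<or> last \<tau> = 1"
proof (rule ccontr)
  assume no_corner: "\<not> ?thesis"
  have set: "set \<tau> = {1..m}" and "distinct \<tau>"
    using \<tau> by (auto simp: Xs_def perms_iff)
  obtain f rest where "\<tau> = f # rest"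
    using length_Xs[OF \<tau>] m by (cases \<tau>) auto
  moreover obtain mid l where "rest = mid @ [l]"
    using length_Xs[OF \<tau>] m calculation by (cases rest rule: rev_cases) auto
  ultimately have \<tau>_eq: "\<tau> = f # mid @ [l]"
    by simp
  have "1 \<in> set \<tau>" "m \<in> set \<tau>"
    using m by (auto simp: set)
  then have "1 \<in> set mid" "m \<in> set mid"
    using no_corner by (auto simp: \<tau>_eq)
  have "f \<in> {1..m}" "l \<in> {1..m}" "f \<noteq> l"
    using \<open>distinct \<tau>\<close> unfolding set[symmetric] by (simp_all add: \<tau>_eq)
  then have bounds: "1 < f" "f < m" "1 < l" "l < m" "f \<noteq> l"
    using no_corner by (auto simp: \<tau>_eq)
  have no_pattern: False if "subseq \<sigma> \<tau>"
    "same_relative_order [2,1,4,3] \<sigma> \<or> same_relative_order [2,4,1,3] \<sigma> \<or>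
     same_relative_order [3,1,4,2] \<sigma> \<or> same_relative_order [3,4,1,2] \<sigma>" for \<sigma>
    using \<tau> that by (auto simp: Xs_def contained_in_def)
  from split_list[OF \<open>1 \<in> set mid\<close>] obtain us vs where mid: "mid = us @ 1 # vs"
    by auto
  then consider "m \<in> set us" | "m \<in> set vs"
    using \<open>m \<in> set mid\<close> m by auto
  then show False
  proof cases
    case 1
    then obtain us1 us2 where "us = us1 @ m # us2"
      by (meson split_list)
    then have "subseq [f, m, 1, l] \<tau>"
      using subseq_four[of f m 1 l us1 us2 vs] by (simp add: \<tau>_eq mid)
    then show False
      by (rule no_pattern) (use bounds in auto)
  next
    case 2
    then obtain vs1 vs2 where "vs = vs1 @ m # vs2"
      by (meson split_list)
    then have "subseq [f, 1, m, l] \<tau>"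
      using subseq_four[of f 1 m l us vs1 vs2] by (simp add: \<tau>_eq mid)
    then show False
      by (rule no_pattern) (use bounds in auto)
  qed
qed

section \<open>Counting the members that contain a pattern\<close>

text \<open>Containment is counted instead of avoidance because removing a corner point turns
  containment of \<alpha> into containment of a pattern derived from \<alpha>, and the empty pattern
  then counts the whole class.\<close>

definition num_containing :: "nat list \<Rightarrow> nat \<Rightarrow> nat" where
  "num_containing \<alpha> m = card {\<tau> \<in> Xs m. contained_in \<alpha> \<tau>}"

lemma num_containing_Nil: "num_containing [] m = card (Xs m)"
  by (simp add: num_containing_def)

lemma num_containing_eq_0: "m < length \<alpha> \<Longrightarrow> num_containing \<alpha> m = 0"
  by (auto simp: num_containing_def dest!: contained_in_length length_Xs)

text \<open>The predicate \<open>P\<close> will express a corner condition; reversal moves the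
  north-west and south-east corners to the north-east and south-west ones.\<close>

lemma card_containing_rev:
  "card {\<tau> \<in> Xs m. contained_in \<alpha> \<tau> \<and> P (rev \<tau>)} = card {\<tau> \<in> Xs m. contained_in (rev \<alpha>) \<tau> \<and> P \<tau>}"
  by (rule bij_betw_same_card[of rev], rule bij_betw_byWitness[where f' = rev])
    (auto simp: contained_in_rev_left)

lemma num_containing_rev: "num_containing (rev \<alpha>) m = num_containing \<alpha> m"
  using card_containing_rev[of m \<alpha> "\<lambda>_. True"] by (simp add: num_containing_def)

lemma Xs_hd_eq_1:
  assumes "\<tau> \<in> Xs (Suc m)" "hd \<tau> = 1"
  obtains \<pi> where "\<tau> = sw \<pi>" "\<pi> \<in> Xs m"
  using assms by (metis perms_hd_eq_1 Xs_subset_perms sw_in_Xs_iff)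

lemma Xs_last_eq:
  assumes "\<tau> \<in> Xs (Suc m)" "last \<tau> = Suc m"
  obtains \<pi> where "\<tau> = ne \<pi>" "\<pi> \<in> Xs m"
  using assms by (metis perms_last_eq Xs_subset_perms ne_in_Xs_iff)

lemma card_containing_hd:
  assumes "\<alpha> \<in> perms n"
  shows "card {\<tau> \<in> Xs (Suc m). contained_in \<alpha> \<tau> \<and> hd \<tau> = 1} = num_containing (del_sw \<alpha>) m"
proof -
  have "{\<tau> \<in> Xs (Suc m). contained_in \<alpha> \<tau> \<and> hd \<tau> = 1} = sw ` {\<tau> \<in> Xs m. contained_in (del_sw \<alpha>) \<tau>}"
    using contained_in_sw_iff[OF assms Xs_subset_perms] by (auto elim!: Xs_hd_eq_1)
  then show ?thesis
    by (simp add: num_containing_def card_image inj_on_subset[OF inj_sw])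
qed

lemma card_containing_last:
  assumes "\<alpha> \<in> perms n"
  shows "card {\<tau> \<in> Xs (Suc m). contained_in \<alpha> \<tau> \<and> last \<tau> = Suc m} = num_containing (del_ne \<alpha>) m"
proof -
  have "{\<tau> \<in> Xs (Suc m). contained_in \<alpha> \<tau> \<and> last \<tau> = Suc m} = ne ` {\<tau> \<in> Xs m. contained_in (del_ne \<alpha>) \<tau>}"
    using contained_in_ne_iff[OF assms Xs_subset_perms] by (auto elim!: Xs_last_eq simp: length_Xs)
  then show ?thesis
    by (simp add: num_containing_def card_image inj_on_subset[OF inj_ne])
qed

text \<open>From size 2 on, the south-west and north-east points are different entries and can be
  removed one after the other.\<close>

lemma card_containing_hd_last:
  assumes "\<alpha> \<in> perms n"
  shows "card {\<tau> \<in> Xs (Suc (Suc m)). contained_in \<alpha> \<tau> \<and> hd \<tau> = 1 \<and> last \<tau> = Suc (Suc m)} =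
    num_containing (del_ne (del_sw \<alpha>)) m"
proof -
  obtain k where k: "del_sw \<alpha> \<in> perms k"
    using del_sw_in_perms[OF assms] by blast
  have last: "last (sw \<tau>) = Suc (last \<tau>)" if "\<tau> \<in> Xs (Suc m)" for \<tau>
    using length_Xs[OF that] by (intro last_sw) auto
  have "{\<tau> \<in> Xs (Suc (Suc m)). contained_in \<alpha> \<tau> \<and> hd \<tau> = 1 \<and> last \<tau> = Suc (Suc m)} =
      sw ` {\<tau> \<in> Xs (Suc m). contained_in (del_sw \<alpha>) \<tau> \<and> last \<tau> = Suc m}" (is "?L = ?R")
  proof (intro equalityI subsetI)
    fix \<tau> assume \<tau>: "\<tau> \<in> ?L"
    then obtain \<pi> where "\<tau> = sw \<pi>" "\<pi> \<in> Xs (Suc m)"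
      using Xs_hd_eq_1[of \<tau> "Suc m"] by auto
    then show "\<tau> \<in> ?R"
      using \<tau> contained_in_sw_iff[OF assms Xs_subset_perms, of \<pi> "Suc m"] last[of \<pi>] by auto
  next
    fix \<tau> assume "\<tau> \<in> ?R"
    then show "\<tau> \<in> ?L"
      using contained_in_sw_iff[OF assms Xs_subset_perms, of _ "Suc m"] last by auto
  qed
  then show ?thesis
    by (simp add: card_containing_last[OF k] card_image inj_on_subset[OF inj_sw])
qed

text \<open>Rules out two corner points of equal height, as needed to see that adjacent corners are
  never both occupied.\<close>

lemma hd_neq_last_Xs: "\<tau> \<in> Xs (Suc (Suc m)) \<Longrightarrow> hd \<tau> \<noteq> last \<tau>"
  using length_Xs[of \<tau> "Suc (Suc m)"]
  by (cases \<tau>; cases "tl \<tau>") (auto simp: Xs_def perms_iff)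

text \<open>Inclusion-exclusion over the four corners of a member of the class; only opposite corners
  can be occupied simultaneously.\<close>

lemma num_containing_rec:
  assumes \<alpha>: "\<alpha> \<in> perms n"
  shows "num_containing \<alpha> (Suc (Suc m)) +
      num_containing (del_ne (del_sw \<alpha>)) m + num_containing (del_ne (del_sw (rev \<alpha>))) m =
    num_containing (del_sw \<alpha>) (Suc m) + num_containing (del_ne \<alpha>) (Suc m) +
    num_containing (del_sw (rev \<alpha>)) (Suc m) + num_containing (del_ne (rev \<alpha>)) (Suc m)"
proof -
  define K where "K = {\<tau> \<in> Xs (Suc (Suc m)). contained_in \<alpha> \<tau>}"
  define A where "A = {\<tau> \<in> K. hd \<tau> = 1}"
  define B where "B = {\<tau> \<in> K. last \<tau> = Suc (Suc m)}"
  define C where "C = {\<tau> \<in> K. hd \<tau> = Suc (Suc m)}"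
  define D where "D = {\<tau> \<in> K. last \<tau> = 1}"
  have rev_\<alpha>: "rev \<alpha> \<in> perms n"
    using \<alpha> by simp
  have fin: "finite A" "finite B" "finite C" "finite D"
    by (simp_all add: A_def B_def C_def D_def K_def)
  have "K = (A \<union> B) \<union> (C \<union> D)"
    using Xs_corner[of _ "Suc (Suc m)"] by (auto simp: A_def B_def C_def D_def K_def)
  moreover have "(A \<union> B) \<inter> (C \<union> D) = {}"
    by (auto simp: A_def B_def C_def D_def K_def dest: hd_neq_last_Xs)
  ultimately have "card K = card (A \<union> B) + card (C \<union> D)"
    using fin by (simp add: card_Un_disjoint)
  moreover have "card (A \<union> B) + card (A \<inter> B) = card A + card B"
    "card (C \<union> D) + card (C \<inter> D) = card C + card D"
    using fin by (simp_all add: card_Un_Int[symmetric])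
  moreover have "card K = num_containing \<alpha> (Suc (Suc m))"
    by (simp add: K_def num_containing_def)
  moreover have "card A = num_containing (del_sw \<alpha>) (Suc m)"
    using card_containing_hd[OF \<alpha>, of "Suc m"] by (simp add: A_def K_def conj_assoc)
  moreover have "card B = num_containing (del_ne \<alpha>) (Suc m)"
    using card_containing_last[OF \<alpha>, of "Suc m"] by (simp add: B_def K_def conj_assoc)
  moreover have "card (A \<inter> B) = num_containing (del_ne (del_sw \<alpha>)) m"
    unfolding card_containing_hd_last[OF \<alpha>, symmetric] A_def B_def K_def
    by (rule arg_cong[of _ _ card]) auto
  \<comment> \<open>The south-east and north-west corners are counted as south-west and north-east
    corners of the reversed permutations.\<close>
  moreover have "card D = num_containing (del_sw (rev \<alpha>)) (Suc m)"
    using card_containing_hd[OF rev_\<alpha>, of "Suc m"]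
      card_containing_rev[of "Suc (Suc m)" \<alpha> "\<lambda>\<tau>. hd \<tau> = 1"]
    by (simp add: D_def K_def conj_assoc hd_rev)
  moreover have "card C = num_containing (del_ne (rev \<alpha>)) (Suc m)"
    using card_containing_last[OF rev_\<alpha>, of "Suc m"]
      card_containing_rev[of "Suc (Suc m)" \<alpha> "\<lambda>\<tau>. last \<tau> = Suc (Suc m)"]
    by (simp add: C_def K_def conj_assoc last_rev)
  moreover have "card (C \<inter> D) = num_containing (del_ne (del_sw (rev \<alpha>))) m"
  proof -
    have "C \<inter> D = {\<tau> \<in> Xs (Suc (Suc m)). contained_in \<alpha> \<tau> \<and> hd (rev \<tau>) = 1 \<and> last (rev \<tau>) = Suc (Suc m)}"
      by (auto simp: C_def D_def K_def hd_rev last_rev)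
    then show ?thesis
      using card_containing_hd_last[OF rev_\<alpha>, of m]
        card_containing_rev[of "Suc (Suc m)" \<alpha> "\<lambda>\<tau>. hd \<tau> = 1 \<and> last \<tau> = Suc (Suc m)"]
      by simp
  qed
  ultimately show ?thesis
    by linarith
qed

section \<open>Growth rate of the class\<close>

lemma Xs_0: "Xs 0 = {[]}"
  by (auto simp: Xs_def perms_def dest!: contained_in_length)

lemma Xs_1: "Xs (Suc 0) = {[1]}"
proof -
  have "\<tau> = [1]" if "\<tau> \<in> Xs (Suc 0)" for \<tau>
    using length_Xs[OF that] that by (cases \<tau>) (auto simp: Xs_def perms_iff)
  moreover have "[1] = sw []" "[] \<in> Xs 0"
    by (simp_all add: sw_def Xs_0)
  ultimately show ?thesis
    by (auto simp: sw_in_Xs_iff simp del: sw_def)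
qed

text \<open>This is the recurrence for the empty pattern, which reversal and all corner deletions
  leave unchanged.\<close>

lemma card_Xs_rec: "card (Xs (Suc (Suc m))) + 2 * card (Xs m) = 4 * card (Xs (Suc m))"
proof -
  have "[] \<in> perms 0" "del_sw [] = []" "del_ne [] = []"
    by (simp_all add: perms_iff del_sw_def del_ne_def)
  then show ?thesis
    using num_containing_rec[of "[]" 0 m] by (simp add: num_containing_Nil)
qed

text \<open>The numbers \<open>2 + sqrt 2\<close> and \<open>2 - sqrt 2\<close> are the roots of the
  characteristic equation \<open>t^2 = 4 * t - 2\<close>, and the initial values at sizes 1 and 2
  are 1 and 2.\<close>

lemma card_Xs: "real (card (Xs (Suc m))) = ((2 + sqrt 2) ^ m + (2 - sqrt 2) ^ m) / 2"
proof (induction m rule: induct_nat_012)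
  case 1
  show ?case
    using card_Xs_rec[of 0] by (simp add: Xs_0 Xs_1)
next
  case (ge2 m)
  have rec: "real (card (Xs (Suc (Suc (Suc m))))) = 4 * real (card (Xs (Suc (Suc m)))) - 2 * real (card (Xs (Suc m)))"
    using card_Xs_rec[of "Suc m"] by linarith
  have sq: "(2 + sqrt 2)\<^sup>2 = 4 * (2 + sqrt 2) - 2" "(2 - sqrt 2)\<^sup>2 = 4 * (2 - sqrt 2) - 2"
    by (simp_all add: power2_eq_square algebra_simps)
  have "x ^ Suc (Suc m) = 4 * x ^ Suc m - 2 * x ^ m" if "x = 2 + sqrt 2 \<or> x = 2 - sqrt 2" for x
  proof -
    have "x\<^sup>2 * x ^ m = (4 * x - 2) * x ^ m"
      using that sq by metis
    then show ?thesis
      by (simp add: power2_eq_square algebra_simps)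
  qed
  from this[of "2 + sqrt 2"] this[of "2 - sqrt 2"] show ?case
    unfolding rec ge2 by simp (simp add: field_simps)
qed (simp add: Xs_1)

text \<open>The smaller root only changes the constant: with \<open>r = 2 + sqrt 2\<close> the count
  lies between \<open>r ^ (n - 1) / 2\<close> and \<open>r ^ (n - 1)\<close>, and n-th roots of
  positive constants tend to 1.\<close>

lemma root_card_Xs_tendsto: "(\<lambda>n. root n (real (card (Xs n)))) \<longlonglongrightarrow> 2 + sqrt 2"
proof -
  define r where "r = 2 + sqrt 2"
  have r: "r > 0" "0 \<le> 2 - sqrt 2" "2 - sqrt 2 \<le> r"
    using sqrt2_less_2 by (auto simp: r_def add_pos_nonneg)
  have bounds: "r * root n (1 / (2 * r)) \<le> root n (real (card (Xs n))) \<and> root n (real (card (Xs n))) \<le> r * root n (1 / r)"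
    if "n > 0" for n
  proof -
    obtain m where n: "n = Suc m"
      using gr0_implies_Suc[OF \<open>n > 0\<close>] by blast
    have "(2 - sqrt 2) ^ m \<le> r ^ m" "0 \<le> (2 - sqrt 2) ^ m"
      using r by (simp_all add: power_mono)
    then have "r ^ m / 2 \<le> real (card (Xs n))" "real (card (Xs n)) \<le> r ^ m"
      by (simp_all add: n card_Xs r_def)
    moreover have "r * root n c = root n (r ^ n * c)" for c
      using r that by (simp add: real_root_mult real_root_power_cancel)
    then have "r * root n (1 / (2 * r)) = root n (r ^ m / 2)" "r * root n (1 / r) = root n (r ^ m)"
      using r by (simp_all add: n)
    ultimately show ?thesis
      using that by simp
  qed
  have lim: "(\<lambda>n. r * root n c) \<longlonglongrightarrow> r" if "c > 0" for c
    using tendsto_mult[OF tendsto_const LIMSEQ_root_const[OF that], of r] by simp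
  have "(\<lambda>n. root n (real (card (Xs n)))) \<longlonglongrightarrow> r"
  proof (rule tendsto_sandwich[OF _ _ lim lim])
    show "\<forall>\<^sub>F n in sequentially. r * root n (1 / (2 * r)) \<le> root n (real (card (Xs n)))"
      "\<forall>\<^sub>F n in sequentially. root n (real (card (Xs n))) \<le> r * root n (1 / r)"
      using bounds by (auto intro: eventually_mono[OF eventually_gt_at_top[of 0]])
  qed (use r in auto)
  then show ?thesis
    by (simp add: r_def)
qed

section \<open>Generating functions and blocks of corner points\<close>

unbundle fps_syntax

definition containing_gf :: "nat list \<Rightarrow> real fps" where
  "containing_gf \<alpha> = Abs_fps (\<lambda>m. real (num_containing \<alpha> m))"

lemma containing_gf_nth [simp]: "containing_gf \<alpha> $ m = real (num_containing \<alpha> m)"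
  by (simp add: containing_gf_def)

lemma containing_gf_rev: "containing_gf (rev \<alpha>) = containing_gf \<alpha>"
  by (simp add: containing_gf_def num_containing_rev)

lemma perms_bounds:
  assumes "\<alpha> \<in> perms n" "n \<ge> 1"
  shows "\<alpha> \<noteq> []" "length \<alpha> = n" "1 \<le> hd \<alpha>" "hd \<alpha> \<le> n" "1 \<le> last \<alpha>" "last \<alpha> \<le> n"
proof -
  show "length \<alpha> = n"
    using assms by (simp add: length_perms)
  then show "\<alpha> \<noteq> []"
    using assms(2) by auto
  then have "hd \<alpha> \<in> {1..n}" "last \<alpha> \<in> {1..n}"
    using assms(1) unfolding perms_iff by (metis hd_in_set, metis last_in_set)
  then show "1 \<le> hd \<alpha>" "hd \<alpha> \<le> n" "1 \<le> last \<alpha>" "last \<alpha> \<le> n"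
    by simp_all
qed

text \<open>Covers a pattern \<beta> with exactly one occupied corner, where \<alpha> is \<beta>
  without that point: the three other deletions return \<beta>, whence the coefficient 3. The
  vanishing initial counts settle the coefficients 0 and 1.\<close>

lemma containing_gf_recurrence:
  assumes "\<And>m. num_containing \<beta> (Suc (Suc m)) + num_containing \<alpha> m + num_containing \<beta> m =
      num_containing \<alpha> (Suc m) + num_containing \<beta> (Suc m) + num_containing \<beta> (Suc m) + num_containing \<beta> (Suc m)"
    and "num_containing \<beta> 0 = 0" "num_containing \<beta> 1 = 0" "num_containing \<alpha> 0 = 0"
  shows "(1 - fps_const 3 * fps_X + fps_X * fps_X) * containing_gf \<beta> =
    (fps_X - fps_X * fps_X) * containing_gf \<alpha>"
proof -
  have "containing_gf \<beta> - fps_const 3 * (fps_X * containing_gf \<beta>) + fps_X * (fps_X * containing_gf \<beta>) =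
    fps_X * containing_gf \<alpha> - fps_X * (fps_X * containing_gf \<alpha>)" (is "?L = ?R")
  proof (rule fps_ext)
    fix m
    consider "m = 0" | "m = 1" | k where "m = Suc (Suc k)"
      by (metis One_nat_def not0_implies_Suc)
    then show "?L $ m = ?R $ m"
    proof cases
      case (3 k)
      then show ?thesis
        using assms(1)[of k] by simp
    qed (use assms in simp_all)
  qed
  then show ?thesis
    by (simp add: algebra_simps)
qed

text \<open>As the north-east corner of \<alpha> is empty, the new point is the only corner point of
  \<open>sw \<alpha>\<close>.\<close>

lemma containing_gf_sw:
  assumes \<alpha>: "\<alpha> \<in> perms n" and n: "n \<ge> 1" and last: "last \<alpha> \<noteq> n"
  shows "(1 - fps_const 3 * fps_X + fps_X * fps_X) * containing_gf (sw \<alpha>) =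
    (fps_X - fps_X * fps_X) * containing_gf \<alpha>"
proof -
  note bounds = perms_bounds[OF \<alpha> n]
  have perm: "sw \<alpha> \<in> perms (Suc n)"
    using \<alpha> by simp
  have "del_ne (sw \<alpha>) = sw \<alpha>" "del_ne \<alpha> = \<alpha>" "del_sw (rev (sw \<alpha>)) = rev (sw \<alpha>)"
    "del_ne (rev (sw \<alpha>)) = rev (sw \<alpha>)"
    using bounds last n by (auto simp: del_ne_def del_sw_def last_sw hd_rev last_rev)
  from num_containing_rec[OF perm, unfolded this del_sw_sw num_containing_rev] show ?thesis
    using bounds n by (intro containing_gf_recurrence) (simp_all add: num_containing_eq_0)
qed

lemma containing_gf_ne:
  assumes \<alpha>: "\<alpha> \<in> perms n" and n: "n \<ge> 1" and hd: "hd \<alpha> \<noteq> 1"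
  shows "(1 - fps_const 3 * fps_X + fps_X * fps_X) * containing_gf (ne \<alpha>) =
    (fps_X - fps_X * fps_X) * containing_gf \<alpha>"
proof -
  note bounds = perms_bounds[OF \<alpha> n]
  have perm: "ne \<alpha> \<in> perms (Suc n)"
    using \<alpha> by simp
  have "del_sw (ne \<alpha>) = ne \<alpha>" "del_sw (rev (ne \<alpha>)) = rev (ne \<alpha>)"
    "del_ne (rev (ne \<alpha>)) = rev (ne \<alpha>)"
    using bounds hd n by (auto simp: del_ne_def del_sw_def hd_ne hd_rev last_rev)
  from num_containing_rec[OF perm, unfolded this del_ne_ne num_containing_rev] show ?thesis
    using bounds n by (intro containing_gf_recurrence) (simp_all add: num_containing_eq_0)
qed

text \<open>Two opposite corners are now occupied, so only the two deletions from the reversed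
  pattern return the pattern itself, whence the coefficient 2.\<close>

lemma containing_gf_sw_ne:
  assumes \<alpha>: "\<alpha> \<in> perms n" and n: "n \<ge> 1"
  shows "(1 - fps_const 2 * fps_X + fps_X * fps_X) * containing_gf (sw (ne \<alpha>)) =
    fps_X * (containing_gf (sw \<alpha>) + containing_gf (ne \<alpha>)) - fps_X * fps_X * containing_gf \<alpha>"
proof -
  note bounds = perms_bounds[OF \<alpha> n]
  define \<beta> where "\<beta> = sw (ne \<alpha>)"
  have perm: "\<beta> \<in> perms (Suc (Suc n))"
    using \<alpha> by (simp add: \<beta>_def)
  have \<beta>_eq: "\<beta> = ne (sw \<alpha>)"
    by (simp add: \<beta>_def ne_sw)
  have "hd \<beta> = 1" "length \<beta> = Suc (Suc n)"
    using bounds by (simp_all add: \<beta>_def)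
  moreover have "last \<beta> = Suc (Suc n)"
    using bounds by (simp add: \<beta>_eq)
  ultimately have "del_sw (rev \<beta>) = rev \<beta>" "del_ne (rev \<beta>) = rev \<beta>"
    by (simp_all add: del_ne_def del_sw_def hd_rev last_rev)
  moreover have "del_sw \<beta> = ne \<alpha>" "del_ne \<beta> = sw \<alpha>"
    by (simp add: \<beta>_def, simp add: \<beta>_eq)
  ultimately have rec: "num_containing \<beta> (Suc (Suc k)) + num_containing \<alpha> k + num_containing \<beta> k =
      num_containing (ne \<alpha>) (Suc k) + num_containing (sw \<alpha>) (Suc k) + 2 * num_containing \<beta> (Suc k)" for k
    using num_containing_rec[OF perm, of k] by (simp add: num_containing_rev)
  have "containing_gf \<beta> - fps_const 2 * (fps_X * containing_gf \<beta>) + fps_X * (fps_X * containing_gf \<beta>) =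
    fps_X * containing_gf (sw \<alpha>) + fps_X * containing_gf (ne \<alpha>) - fps_X * (fps_X * containing_gf \<alpha>)"
    (is "?L = ?R")
  proof (rule fps_ext)
    fix m
    consider "m = 0" | "m = 1" | k where "m = Suc (Suc k)"
      by (metis One_nat_def not0_implies_Suc)
    then show "?L $ m = ?R $ m"
    proof cases
      case (3 k)
      then show ?thesis
        using rec[of k] by simp
    qed (use bounds n in \<open>simp_all add: num_containing_eq_0 \<beta>_def\<close>)
  qed
  then show ?thesis
    by (simp add: algebra_simps \<beta>_def)
qed

text \<open>The factor contributed by \<open>a\<close> south-west and \<open>b\<close> north-east
  points. Its equations are the three identities above, solved for the largest pattern; the inverted
  series have constant term 1.\<close>

fun block_gf :: "nat \<Rightarrow> nat \<Rightarrow> real fps" where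
  "block_gf 0 0 = 1"
| "block_gf (Suc a) 0 =
     inverse (1 - fps_const 3 * fps_X + fps_X * fps_X) * ((fps_X - fps_X * fps_X) * block_gf a 0)"
| "block_gf 0 (Suc b) =
     inverse (1 - fps_const 3 * fps_X + fps_X * fps_X) * ((fps_X - fps_X * fps_X) * block_gf 0 b)"
| "block_gf (Suc a) (Suc b) =
     inverse (1 - fps_const 2 * fps_X + fps_X * fps_X) *
     (fps_X * (block_gf (Suc a) b + block_gf a (Suc b)) - fps_X * fps_X * block_gf a b)"

lemma fps_eq_inverse_times:
  fixes u f g :: "real fps"
  assumes "u * f = g" "u $ 0 \<noteq> 0"
  shows "f = inverse u * g"
  by (metis assms inverse_mult_eq_1 mult.assoc mult_1)

lemma ne_funpow_sw: "ne ((sw ^^ a) \<pi>) = (sw ^^ a) (ne \<pi>)"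
  by (induction a) (simp_all add: ne_sw)

lemma funpow_sw_in_perms: "\<pi> \<in> perms n \<Longrightarrow> (sw ^^ a) \<pi> \<in> perms (a + n)"
  and funpow_ne_in_perms: "\<pi> \<in> perms n \<Longrightarrow> (ne ^^ a) \<pi> \<in> perms (a + n)"
  by (induction a) simp_all

lemma last_funpow_sw: "\<pi> \<noteq> [] \<Longrightarrow> (sw ^^ a) \<pi> \<noteq> [] \<and> last ((sw ^^ a) \<pi>) = a + last \<pi>"
  and hd_funpow_ne: "\<pi> \<noteq> [] \<Longrightarrow> (ne ^^ a) \<pi> \<noteq> [] \<and> hd ((ne ^^ a) \<pi>) = hd \<pi>"
  by (induction a) (simp_all add: last_sw hd_ne)

text \<open>Induction along the recursion of \<open>block_gf\<close>. The conditions on \<beta> keep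
  the opposite corner empty as long as points have been added on one side only.\<close>

lemma containing_gf_block:
  assumes \<beta>: "\<beta> \<in> perms n" and n: "n \<ge> 1" and "hd \<beta> \<noteq> 1" "last \<beta> \<noteq> n"
  shows "containing_gf ((sw ^^ a) ((ne ^^ b) \<beta>)) = block_gf a b * containing_gf \<beta>"
proof (induction a b rule: block_gf.induct)
  case (2 a)
  \<comment> \<open>South-west points raise the last entry and the size by the same amount.\<close>
  have "last ((sw ^^ a) \<beta>) \<noteq> a + n"
    using last_funpow_sw[of \<beta> a] perms_bounds[OF \<beta> n] assms(4) by simp
  from containing_gf_sw[OF funpow_sw_in_perms[OF \<beta>] _ this] n 2 show ?case
    by (auto dest: fps_eq_inverse_times simp: mult.assoc)
next
  case (3 b)
  have "hd ((ne ^^ b) \<beta>) \<noteq> 1"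
    using hd_funpow_ne[of \<beta> b] perms_bounds[OF \<beta> n] assms(3) by simp
  from containing_gf_ne[OF funpow_ne_in_perms[OF \<beta>] _ this] n 3 show ?case
    by (auto dest: fps_eq_inverse_times simp: mult.assoc)
next
  case (4 a b)
  let ?\<alpha> = "(sw ^^ a) ((ne ^^ b) \<beta>)"
  have eqs: "sw ?\<alpha> = (sw ^^ Suc a) ((ne ^^ b) \<beta>)" "ne ?\<alpha> = (sw ^^ a) ((ne ^^ Suc b) \<beta>)"
    "sw (ne ?\<alpha>) = (sw ^^ Suc a) ((ne ^^ Suc b) \<beta>)"
    by (simp_all add: ne_funpow_sw)
  have "?\<alpha> \<in> perms (a + (b + n))"
    using \<beta> by (intro funpow_sw_in_perms funpow_ne_in_perms)
  from containing_gf_sw_ne[OF this, unfolded eqs 4] n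
  have "(1 - fps_const 2 * fps_X + fps_X * fps_X) * containing_gf ((sw ^^ Suc a) ((ne ^^ Suc b) \<beta>)) =
    (fps_X * (block_gf (Suc a) b + block_gf a (Suc b)) - fps_X * fps_X * block_gf a b) * containing_gf \<beta>"
    by (simp add: ring_distribs mult.assoc)
  from fps_eq_inverse_times[OF this] show ?case
    by (simp add: mult.assoc)
qed simp

text \<open>Since \<open>sw\<close> and \<open>ne\<close> commute, points removed in any order can
  be sorted into \<open>a\<close> and \<open>b\<close>. Peeling stops at size 1, because a single
  point occupies every corner.\<close>

lemma strip_block:
  assumes "\<alpha> \<in> Xs n" "n \<ge> 1"
  obtains a b k \<beta> where "\<alpha> = (sw ^^ a) ((ne ^^ b) \<beta>)" "\<beta> \<in> Xs k" "n = a + b + k" "k \<ge> 1"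
    "k = 1 \<or> hd \<beta> \<noteq> 1 \<and> last \<beta> \<noteq> k"
proof -
  have "\<exists>a b k \<beta>. \<alpha> = (sw ^^ a) ((ne ^^ b) \<beta>) \<and> \<beta> \<in> Xs k \<and> n = a + b + k \<and> k \<ge> 1 \<and>
      (k = 1 \<or> hd \<beta> \<noteq> 1 \<and> last \<beta> \<noteq> k)"
    using assms
  proof (induction n arbitrary: \<alpha>)
    case (Suc n)
    consider "n = 0 \<or> hd \<alpha> \<noteq> 1 \<and> last \<alpha> \<noteq> Suc n" | "n \<ge> 1" "hd \<alpha> = 1" | "n \<ge> 1" "last \<alpha> = Suc n"
      by linarith
    then show ?case
    proof cases
      case 1
      with Suc.prems show ?thesis
        by (intro exI[of _ 0] exI[of _ "Suc n"] exI[of _ \<alpha>]) auto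
    next
      case 2
      obtain \<pi> where \<pi>: "\<alpha> = sw \<pi>" "\<pi> \<in> Xs n"
        using Suc.prems(1) 2(2) by (rule Xs_hd_eq_1)
      with Suc.IH[OF \<pi>(2) 2(1)] obtain a b k \<beta> where
        "\<pi> = (sw ^^ a) ((ne ^^ b) \<beta>)" "\<beta> \<in> Xs k" "n = a + b + k" "k \<ge> 1" "k = 1 \<or> hd \<beta> \<noteq> 1 \<and> last \<beta> \<noteq> k"
        by blast
      then show ?thesis
        using \<pi>(1) by (intro exI[of _ "Suc a"] exI[of _ b] exI[of _ k] exI[of _ \<beta>]) auto
    next
      case 3
      obtain \<pi> where \<pi>: "\<alpha> = ne \<pi>" "\<pi> \<in> Xs n"
        using Suc.prems(1) 3(2) by (rule Xs_last_eq)
      with Suc.IH[OF \<pi>(2) 3(1)] obtain a b k \<beta> where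
        "\<pi> = (sw ^^ a) ((ne ^^ b) \<beta>)" "\<beta> \<in> Xs k" "n = a + b + k" "k \<ge> 1" "k = 1 \<or> hd \<beta> \<noteq> 1 \<and> last \<beta> \<noteq> k"
        by blast
      then show ?thesis
        using \<pi>(1) by (intro exI[of _ a] exI[of _ "Suc b"] exI[of _ k] exI[of _ \<beta>]) (auto simp: ne_funpow_sw)
    qed
  qed simp
  then show ?thesis
    using that by blast
qed

text \<open>A block around a single point is an increasing permutation, which depends on
  \<open>a + b\<close> only; this describes the innermost layer.\<close>

lemma sw_ne_increasing: "(sw ^^ a) ((ne ^^ b) [1]) = [1..<Suc (a + b + 1)]"
proof -
  have "(ne ^^ b) [1] = [1..<Suc (b + 1)]"
    by (induction b) (simp_all add: ne_def)
  moreover have "sw [1..<Suc k] = [1..<Suc (Suc k)]" for k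
    unfolding sw_def by (metis One_nat_def Suc_le_mono le0 map_Suc_upt le_imp_less_Suc upt_conv_Cons)
  then have "(sw ^^ a) [1..<Suc k] = [1..<Suc (a + k)]" for k
    by (induction a) simp_all
  ultimately show ?thesis
    by (simp only: add.assoc)
qed

section \<open>Factorization over multisets of blocks\<close>

definition weight :: "(nat \<times> nat) multiset \<Rightarrow> nat" where
  "weight M = (\<Sum>(a, b)\<in>#M. a + b)"

lemma weight_simps [simp]: "weight {#} = 0" "weight (add_mset (a, b) M) = a + b + weight M"
  by (simp_all add: weight_def)

text \<open>The generating function forgets the order in which the blocks of a permutation are nested.\<close>

lemma containing_gf_factorization:
  assumes "\<alpha> \<in> Xs n" "n \<ge> 1"
  shows "\<exists>M. (0, 0) \<notin># M \<and> weight M < n \<and>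
    containing_gf \<alpha> = (\<Prod>(a, b)\<in>#M. block_gf a b) * containing_gf [1..<Suc (n - weight M)]"
  using assms
proof (induction n arbitrary: \<alpha> rule: less_induct)
  case (less n)
  show ?case
  proof (cases "n = 1")
    case True
    with less.prems show ?thesis
      by (intro exI[of _ "{#}"]) (simp add: Xs_1)
  next
    case False
    \<comment> \<open>Reversing if necessary puts a corner point in the south-west or north-east
      without changing the generating function.\<close>
    obtain \<alpha>' where \<alpha>': "\<alpha>' \<in> Xs n" "hd \<alpha>' = 1 \<or> last \<alpha>' = n" "containing_gf \<alpha>' = containing_gf \<alpha>"
    proof (cases "hd \<alpha> = 1 \<or> last \<alpha> = n")
      case True
      then show ?thesis
        using that[of \<alpha>] less.prems by simp
    next
      case 2: False
      then have "hd (rev \<alpha>) = 1 \<or> last (rev \<alpha>) = n"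
        using Xs_corner[OF less.prems(1)] less.prems(2) False by (simp add: hd_rev last_rev) linarith
      then show ?thesis
        using that[of "rev \<alpha>"] less.prems by (simp add: containing_gf_rev)
    qed
    obtain a b k \<beta> where \<beta>: "\<alpha>' = (sw ^^ a) ((ne ^^ b) \<beta>)" "\<beta> \<in> Xs k" "n = a + b + k" "k \<ge> 1"
      "k = 1 \<or> hd \<beta> \<noteq> 1 \<and> last \<beta> \<noteq> k"
      using strip_block[OF \<alpha>'(1) less.prems(2)] by metis
    show ?thesis
    proof (cases "k = 1")
      case True
      then have "\<alpha>' = [1..<Suc n]"
        using \<beta>(1-3) by (simp add: Xs_1 sw_ne_increasing[unfolded One_nat_def])
      then show ?thesis
        using \<alpha>'(3) less.prems(2) by (intro exI[of _ "{#}"]) simp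
    next
      case k: False
      \<comment> \<open>The occupied corner of \<open>\<alpha>'\<close> cannot belong to the core
        \<beta>, so the block is nonempty and the core is smaller.\<close>
      then have "(a, b) \<noteq> (0, 0)"
        using \<alpha>'(2) \<beta> k by (auto intro!: gr0I)
      then have "k < n"
        using \<beta>(3) by auto
      from less.IH[OF this \<beta>(2,4)] obtain M where M: "(0, 0) \<notin># M" "weight M < k"
        "containing_gf \<beta> = (\<Prod>(a, b)\<in>#M. block_gf a b) * containing_gf [1..<Suc (k - weight M)]"
        by blast
      have "containing_gf \<alpha> = block_gf a b * containing_gf \<beta>"
        using containing_gf_block[OF Xs_subset_perms[OF \<beta>(2)] \<beta>(4)] \<beta>(1,5) k \<alpha>'(3) by simp
      \<comment> \<open>The innermost increasing permutation is the same for \<alpha> and \<beta>,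
        so its size is recovered from \<open>n\<close> and the multiset.\<close>
      moreover have "n - weight (add_mset (a, b) M) = k - weight M"
        using \<beta>(3) by simp
      ultimately show ?thesis
        using M \<beta>(3) \<open>(a, b) \<noteq> (0, 0)\<close>
        by (intro exI[of _ "add_mset (a, b) M"]) (simp add: mult.assoc)
    qed
  qed
qed

section \<open>Counting Wilf classes by counting multisets\<close>

text \<open>Avoiders are the complement of the containing members. Size 0 is treated apart, since
  the class is empty there while \<open>Xs 0\<close> is not.\<close>

lemma wilf_equivalent_if_containing_gf_eq:
  assumes "\<alpha> \<in> X_class" "\<beta> \<in> X_class" "containing_gf \<alpha> = containing_gf \<beta>"
  shows "(\<alpha>, \<beta>) \<in> wilf_equivalence X_class"
proof -
  have avoiding: "card {\<tau> \<in> of_size X_class m. avoids \<tau> \<gamma>} = card (Xs m) - num_containing \<gamma> m"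
    if "m \<ge> 1" for m \<gamma>
  proof -
    have "{\<tau> \<in> of_size X_class m. avoids \<tau> \<gamma>} = Xs m - {\<tau> \<in> Xs m. contained_in \<gamma> \<tau>}"
      using that by (auto simp: of_size_X_class_eq_Xs)
    then show ?thesis
      by (simp add: num_containing_def card_Diff_subset)
  qed
  have "num_containing \<alpha> m = num_containing \<beta> m" for m
    using arg_cong[OF assms(3), of "\<lambda>f. f $ m"] by simp
  moreover have "of_size X_class 0 = {}"
    by (auto simp: of_size_def X_class_def dest: length_perms)
  ultimately have "card {\<tau> \<in> of_size X_class m. avoids \<tau> \<alpha>} = card {\<tau> \<in> of_size X_class m. avoids \<tau> \<beta>}" for m
    by (cases "m = 0") (simp_all add: avoiding Suc_le_eq)
  then show ?thesis
    using assms by (simp add: wilf_equivalence_def)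
qed

text \<open>Every class is recovered from a value of \<open>f\<close> by choosing some element with
  that value.\<close>

lemma card_quotient_le_card_image:
  assumes "equiv A r" "finite A" "\<And>x y. x \<in> A \<Longrightarrow> y \<in> A \<Longrightarrow> f x = f y \<Longrightarrow> (x, y) \<in> r"
  shows "card (A // r) \<le> card (f ` A)"
proof -
  have "A // r \<subseteq> (\<lambda>v. r `` {SOME a. a \<in> A \<and> f a = v}) ` (f ` A)"
  proof
    fix c assume "c \<in> A // r"
    then obtain x where x: "x \<in> A" "c = r `` {x}"
      by (auto simp: quotient_def)
    define y where "y = (SOME a. a \<in> A \<and> f a = f x)"
    have "y \<in> A \<and> f y = f x"
      unfolding y_def by (rule someI[of _ x]) (use x in auto)
    then have "c = r `` {y}"
      using x assms(1,3) by (metis equiv_class_eq)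
    then show "c \<in> (\<lambda>v. r `` {SOME a. a \<in> A \<and> f a = v}) ` (f ` A)"
      using x(1) by (auto simp: y_def)
  qed
  then show ?thesis
    using assms(2) by (meson card_image_le card_mono finite_imageI le_trans)
qed

text \<open>Each pair other than \<open>(0, 0)\<close> contributes at least 1. This bounds the
  multiplicities in a multiset of bounded weight.\<close>

lemma size_le_weight: "(0, 0) \<notin># M \<Longrightarrow> size M \<le> weight M"
  by (induction M) (auto simp: Suc_le_eq)

lemma power_weight: "x ^ weight M = (\<Prod>p\<in>#M. x ^ (fst p + snd p))" for x :: real
  by (induction M) (auto simp: power_add)

lemma member_le_weight: "(a, b) \<in># M \<Longrightarrow> a + b \<le> weight M"
  by (induction M) auto

text \<open>The weight enumerator of these multisets is the truncation of
  \<open>\<Prod>1 / (1 - x\<^bsup>a+b\<^esup>)\<close>, and \<open>1 / (1 - y) \<le> exp (y / (1 - y))\<close>.\<close>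

lemma card_multisets_bound:
  fixes x :: real and n :: nat
  assumes x: "0 < x" "x < 1"
  defines "S \<equiv> {M. (0, 0) \<notin># M \<and> weight M \<le> n}"
  shows "finite S" "real (card S) * x ^ n \<le> exp (1 / (1 - x) ^ 3)"
proof -
  define T :: "(nat \<times> nat) set" where "T = {..n} \<times> {..n} - {(0, 0)}"
  define w :: "nat \<times> nat \<Rightarrow> nat" where "w p = fst p + snd p" for p
  have T: "finite T"
    by (simp add: T_def)
  have set_S: "set_mset M \<subseteq> T" if "M \<in> S" for M
  proof
    fix p assume "p \<in> set_mset M"
    moreover obtain a b where "p = (a, b)"
      by (cases p)
    ultimately show "p \<in> T"
      using that member_le_weight[of a b M] by (auto simp: S_def T_def intro!: gr0I)
  qed
  \<comment> \<open>A multiset in \<open>S\<close> is encoded by its multiplicities on the finite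
    set \<open>T\<close>, all at most \<open>n\<close>.\<close>
  let ?\<phi> = "\<lambda>M. restrict (count M) T"
  let ?P = "T \<rightarrow>\<^sub>E {..n}"
  have "inj_on ?\<phi> S"
  proof (rule inj_onI)
    fix M N assume *: "M \<in> S" "N \<in> S" "?\<phi> M = ?\<phi> N"
    show "M = N"
    proof (rule multiset_eqI)
      fix p
      show "count M p = count N p"
      proof (cases "p \<in> T")
        case True
        then show ?thesis
          using fun_cong[OF *(3), of p] by simp
      next
        case False
        then show ?thesis
          using set_S[OF *(1)] set_S[OF *(2)] by (metis not_in_iff subsetD)
      qed
    qed
  qed
  moreover have image: "?\<phi> ` S \<subseteq> ?P"
  proof -
    have "count M p \<le> n" if "M \<in> S" for M p
      using that size_le_weight[of M] count_le_size[of M p] by (auto simp: S_def)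
    then show ?thesis
      by auto
  qed
  moreover have fin_P: "finite ?P"
    using T by (intro finite_PiE) auto
  ultimately show "finite S"
    by (meson finite_imageD finite_subset)
  have pow: "x ^ weight M = (\<Prod>p\<in>T. (x ^ w p) ^ ?\<phi> M p)" if "M \<in> S" for M
  proof -
    have "x ^ weight M = (\<Prod>p\<in>set_mset M. (x ^ w p) ^ count M p)"
      by (simp add: power_weight image_prod_mset_multiplicity w_def)
    also have "\<dots> = (\<Prod>p\<in>T. (x ^ w p) ^ count M p)"
      using T set_S[OF that] by (intro prod.mono_neutral_left) (auto simp: not_in_iff)
    finally show ?thesis
      by simp
  qed
  have "real (card S) * x ^ n = (\<Sum>M\<in>S. x ^ n)"
    by simp
  also have "\<dots> \<le> (\<Sum>M\<in>S. x ^ weight M)"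
    using x by (intro sum_mono power_decreasing) (auto simp: S_def)
  also have "\<dots> = (\<Sum>M\<in>S. \<Prod>p\<in>T. (x ^ w p) ^ ?\<phi> M p)"
    using pow by (intro sum.cong) auto
  also have "\<dots> = (\<Sum>g\<in>?\<phi> ` S. \<Prod>p\<in>T. (x ^ w p) ^ g p)"
    using \<open>inj_on ?\<phi> S\<close> by (simp add: sum.reindex)
  \<comment> \<open>Enlarging the range to all functions from \<open>T\<close> to
    \<open>{..n}\<close> lets the sum factor into a product of truncated geometric series.\<close>
  also have "\<dots> \<le> (\<Sum>g\<in>?P. \<Prod>p\<in>T. (x ^ w p) ^ g p)"
    using fin_P image x by (intro sum_mono2 prod_nonneg) auto
  also have "\<dots> = (\<Prod>p\<in>T. \<Sum>j\<le>n. (x ^ w p) ^ j)"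
    using T by (simp add: prod_sum_PiE)
  also have "\<dots> \<le> (\<Prod>p\<in>T. exp (x ^ w p / (1 - x)))"
  proof (intro prod_mono conjI sum_nonneg)
    fix p assume "p \<in> T"
    then have "w p \<ge> 1"
      by (auto simp: T_def w_def)
    then have y: "0 < x ^ w p" "x ^ w p \<le> x"
      using x power_decreasing[of 1 "w p" x] by auto
    then have "(\<Sum>j\<le>n. (x ^ w p) ^ j) \<le> 1 / (1 - x ^ w p)"
      using x by (intro less_imp_le geometric_sum_less) auto
    also have "\<dots> = 1 + x ^ w p / (1 - x ^ w p)"
      using x y by (simp add: field_simps)
    also have "\<dots> \<le> exp (x ^ w p / (1 - x ^ w p))"
      by (rule exp_ge_add_one_self)
    also have "\<dots> \<le> exp (x ^ w p / (1 - x))"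
      using x y by (simp add: frac_le)
    finally show "(\<Sum>j\<le>n. (x ^ w p) ^ j) \<le> exp (x ^ w p / (1 - x))" .
  qed (use x in auto)
  also have "\<dots> = exp (\<Sum>p\<in>T. x ^ w p / (1 - x))"
    using T by (simp add: exp_sum)
  also have "\<dots> \<le> exp (1 / (1 - x) ^ 3)"
  proof -
    \<comment> \<open>Restoring \<open>(0, 0)\<close> makes this a product of two geometric sums;
      with the remaining division by \<open>1 - x\<close> the exponent becomes 3.\<close>
    have "(\<Sum>p\<in>T. x ^ w p) \<le> (\<Sum>p\<in>{..n} \<times> {..n}. x ^ w p)"
      using x by (intro sum_mono2) (auto simp: T_def)
    also have "\<dots> = (\<Sum>a\<le>n. x ^ a) * (\<Sum>b\<le>n. x ^ b)"
      by (simp add: sum_product sum.cartesian_product w_def power_add case_prod_unfold)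
    also have "\<dots> \<le> (1 / (1 - x)) * (1 / (1 - x))"
      using x by (intro mult_mono less_imp_le[OF geometric_sum_less] sum_nonneg) auto
    finally have "(\<Sum>p\<in>T. x ^ w p) / (1 - x) \<le> (1 / (1 - x)) * (1 / (1 - x)) / (1 - x)"
      using x by (intro divide_right_mono) auto
    then show ?thesis
      by (simp add: sum_divide_distrib power3_eq_cube)
  qed
  finally show "real (card S) * x ^ n \<le> exp (1 / (1 - x) ^ 3)" .
qed

section \<open>Subexponential growth of the number of Wilf classes\<close>

lemma num_wilf_classes_bound:
  fixes x :: real
  assumes x: "0 < x" "x < 1" and n: "n \<ge> 1"
  shows "real (num_wilf_classes X_class n) * x ^ n \<le> exp (1 / (1 - x) ^ 3)"
proof -
  define S where "S = {M. (0, 0) \<notin># M \<and> weight M \<le> n}"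
  define G where "G M = (\<Prod>(a, b)\<in>#M. block_gf a b) * containing_gf [1..<Suc (n - weight M)]" for M
  have S: "finite S" "real (card S) * x ^ n \<le> exp (1 / (1 - x) ^ 3)"
    using card_multisets_bound[OF x, of n] by (simp_all add: S_def)
  have "num_wilf_classes X_class n \<le> card (containing_gf ` of_size X_class n)"
    unfolding num_wilf_classes_def
    by (intro card_quotient_le_card_image equiv_wilf_equivalence finite_of_size_X_class)
      (auto intro: wilf_equivalent_if_containing_gf_eq simp: of_size_def)
  \<comment> \<open>At fixed size \<open>n\<close> the generating function is a function of the
    multiset of blocks alone.\<close>
  also have "containing_gf ` of_size X_class n \<subseteq> G ` S"
    using containing_gf_factorization[OF _ n] by (fastforce simp: of_size_X_class_eq_Xs[OF n] S_def G_def)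
  then have "card (containing_gf ` of_size X_class n) \<le> card S"
    using S(1) by (meson card_image_le card_mono finite_imageI le_trans)
  finally show ?thesis
    using S(2) x by (meson mult_right_mono of_nat_mono order_trans zero_le_power less_imp_le)
qed

lemma num_wilf_classes_pos:
  assumes "n \<ge> 1"
  shows "num_wilf_classes X_class n \<ge> 1"
proof -
  have "(sw ^^ n) [] \<in> Xs n"
    by (induction n) (simp_all add: Xs_0)
  then have "of_size X_class n // Restr (wilf_equivalence X_class) (of_size X_class n) \<noteq> {}"
    using assms by (auto simp: of_size_X_class_eq_Xs quotient_def)
  moreover have "finite (of_size X_class n // Restr (wilf_equivalence X_class) (of_size X_class n))"
    by (rule finite_quotient) (auto simp: finite_of_size_X_class)
  ultimately show ?thesis
    by (simp add: num_wilf_classes_def card_gt_0_iff Suc_le_eq)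
qed

text \<open>Positivity gives the lower bound. For the upper one, take \<open>1 < d < c\<close> and
  \<open>x = 1 / d\<close>: the count is at most a constant times \<open>d ^ n\<close>, and the n-th
  root of this tends to \<open>d\<close>.\<close>

lemma root_num_wilf_classes_tendsto: "(\<lambda>n. root n (real (num_wilf_classes X_class n))) \<longlonglongrightarrow> 1"
proof (rule order_tendstoI)
  fix c :: real assume "c < 1"
  moreover have "1 \<le> root n (real (num_wilf_classes X_class n))" if "n > 0" for n
    using that num_wilf_classes_pos[of n] by simp
  ultimately show "\<forall>\<^sub>F n in sequentially. c < root n (real (num_wilf_classes X_class n))"
    by (intro eventually_mono[OF eventually_gt_at_top[of 0]]) (auto intro: less_le_trans)
next
  fix c :: real assume c: "1 < c"
  then obtain d where d: "1 < d" "d < c"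
    using dense by blast
  define x where "x = 1 / d"
  have x: "0 < x" "x < 1"
    using d by (simp_all add: x_def)
  have "(\<lambda>n. d * root n (exp (1 / (1 - x) ^ 3))) \<longlonglongrightarrow> d"
    using tendsto_mult[OF tendsto_const LIMSEQ_root_const[of "exp (1 / (1 - x) ^ 3)"], of d] by simp
  then have "\<forall>\<^sub>F n in sequentially. d * root n (exp (1 / (1 - x) ^ 3)) < c"
    using d(2) by (rule order_tendstoD)
  then show "\<forall>\<^sub>F n in sequentially. root n (real (num_wilf_classes X_class n)) < c"
    using eventually_gt_at_top[of 0]
  proof eventually_elim
    case (elim n)
    have "real (num_wilf_classes X_class n) \<le> d ^ n * exp (1 / (1 - x) ^ 3)"
      using num_wilf_classes_bound[OF x, of n] elim d by (simp add: x_def field_simps)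
    then have "root n (real (num_wilf_classes X_class n)) \<le> root n (d ^ n * exp (1 / (1 - x) ^ 3))"
      using elim by simp
    also have "\<dots> = d * root n (exp (1 / (1 - x) ^ 3))"
      using elim d by (simp add: real_root_mult real_root_power_cancel)
    also have "\<dots> < c"
      by (rule elim)
    finally show ?case .
  qed
qed

theorem theorem2p6:
  "(\<lambda>n. root n (real (card (of_size X_class n)))) \<longlonglongrightarrow> 2 + sqrt 2 \<and>
   (\<lambda>n. root n (real (num_wilf_classes X_class n))) \<longlonglongrightarrow> 1"
proof
  \<comment> \<open>The two families differ only at size 0, which does not affect the limit.\<close>
  have "\<forall>\<^sub>F n in sequentially. root n (real (card (Xs n))) = root n (real (card (of_size X_class n)))"
    by (rule eventually_mono[OF eventually_ge_at_top[of 1]]) (simp add: of_size_X_class_eq_Xs)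
  with root_card_Xs_tendsto show "(\<lambda>n. root n (real (card (of_size X_class n)))) \<longlonglongrightarrow> 2 + sqrt 2"
    by (rule Lim_transform_eventually)
qed (rule root_num_wilf_classes_tendsto)

end
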